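(* Let $X$ be a (nonempty) compact semi-algebraic set which is the geometric realization of a finite simplicial complex $K$, and let $\Delta(K)$ be the associated simplicial set, regarded as a simplicial space with each $\Delta(K)_n$ discrete. Write $Y_n=\Delta(K)_n$. Then for every $n\ge0$ the space $Y_n$ admits the following decompositions after one suspension: there are homotopy equivalences $$\Theta(n):\Sigma(Y_n)\longrightarrow\bigvee_{0\le r\le n}\Sigma\big(S^r(Y_n)/S^{r+1}(Y_n)\big),$$ $$H(n):\Sigma(Y_n)\longrightarrow\bigvee_{0\le r\le n}\ \bigvee_{J}\Sigma\big(\widehat{s_J(Y_{n-r})}\big),$$ where $J$ runs over all admissible sequences with $|J|=r$, and for each $0\le t\le n$ the map $H(n)$ restricts to a homotopy equivalence $$H(n)|_t:\Sigma(S^t(Y_n))\longrightarrow\bigvee_{t\le r\le n}\ \bigvee_{J}\Sigma\big(\widehat{s_J(Y_{n-r})}\big).$$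
   Context: A real semi-algebraic set is a subset of some $\mathbb{R}^k$ (with the Euclidean topology) which is a finite union of sets each determined by a finite number of polynomial inequalities. For an abstract simplicial complex $K$ with vertices labeled by $[m]=\{1,\dots,m\}$, $\Delta(K)$ is the simplicial set whose $n$-simplices are the $(n+1)$-tuples of vertices $(v_0,\dots,v_n)$ with $v_0\le\cdots\le v_n$ and such that $\{v_0,\dots,v_n\}$ is a simplex of $K$; $d_i$ omits $v_i$ and $s_i$ repeats $v_i$. For a simplicial space $Y_\bullet$ a base-point $y_0\in Y_0$ is fixed; $Y_n$ and its subspaces $S^t(Y_n)$ ($t\le n$) are based at $s_0^n(y_0)$, and $\Sigma$ is the reduced suspension. $S^0(Y_n)=Y_n$, $S^t(Y_n)=\bigcup s_{i_1}s_{i_2}\cdots s_{i_t}(Y_{n-t})\subset Y_n$ (union over all $t$-fold composites of degeneracies $Y_{n-t}\to Y_n$), $S(Y_n)=S^1(Y_n)$, and $S^{n+1}(Y_n)=\emptyset$. A quotient by the empty set means the space itself; a quotient $Z/B$ with $B\ne\emptyset$ is based at the class of $B$. A sequence $J=(j_r,j_{r-1},\dots,j_1)$ with $|J|=r$ is admissible (for $Y_n$) if $n-1\ge j_r>j_{r-1}>\cdots>j_1\ge0$ (the empty sequence is admissible, $|J|=0$). Write $s_J=s_{j_r}s_{j_{r-1}}\cdots s_{j_1}:Y_{n-r}\to Y_n$ and $\widehat{s_J(Y_{n-r})}=s_J(Y_{n-r})/s_J(S(Y_{n-r}))$; for $r=n$ this is $s_0^n(Y_0)$. *)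

theory Defs
  imports "HOL-Analysis.Analysis"
begin

section \<open>Semi-algebraic sets\<close>

definition basic_semialgebraic :: "(real ^ 'k) set \<Rightarrow> bool" where
  "basic_semialgebraic C \<longleftrightarrow>
     (\<exists>P Q. finite P \<and> finite Q \<and> (\<forall>p \<in> P \<union> Q. real_polynomial_function p) \<and>
        C = {x. (\<forall>p \<in> P. p x \<ge> 0) \<and> (\<forall>q \<in> Q. q x > 0)})"

definition semialgebraic :: "(real ^ 'k) set \<Rightarrow> bool" where
  "semialgebraic S \<longleftrightarrow>
     (\<exists>\<C>. finite \<C> \<and> (\<forall>C \<in> \<C>. basic_semialgebraic C) \<and> S = \<Union>\<C>)"


section \<open>Abstract simplicial complexes\<close>

text \<open>The empty set may or may not be listed among the simplices; nothing below depends on it.\<close>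

definition abstract_simplicial_complex :: "nat \<Rightarrow> nat set set \<Rightarrow> bool" where
  "abstract_simplicial_complex m K \<longleftrightarrow>
     K \<subseteq> Pow {1..m} \<and> (\<forall>v \<in> {1..m}. {v} \<in> K) \<and>
     (\<forall>\<sigma> \<in> K. \<forall>\<tau>. \<tau> \<subseteq> \<sigma> \<and> \<tau> \<noteq> {} \<longrightarrow> \<tau> \<in> K)"

text \<open>Barycentric coordinates. For a finite complex, the topology inherited from
  \<open>nat \<Rightarrow> real\<close> (topology of pointwise convergence) is the Euclidean one.\<close>

definition geometric_realization :: "nat set set \<Rightarrow> (nat \<Rightarrow> real) set" where
  "geometric_realization K =
     {x. (\<forall>v. 0 \<le> x v) \<and> {v. x v \<noteq> 0} \<in> K \<and> (\<Sum>v | x v \<noteq> 0. x v) = 1}"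


section \<open>Simplicial spaces\<close>

text \<open>\<open>face Y n i\<close> is $d_i$ from level \<open>n\<close> to level \<open>n - 1\<close>, and
  \<open>degen Y n i\<close> is $s_i$ from level \<open>n\<close> to level \<open>n + 1\<close>.\<close>

record 'a simplicial =
  level :: "nat \<Rightarrow> 'a topology"
  face :: "nat \<Rightarrow> nat \<Rightarrow> 'a \<Rightarrow> 'a"
  degen :: "nat \<Rightarrow> nat \<Rightarrow> 'a \<Rightarrow> 'a"

definition simplicial_space :: "'a simplicial \<Rightarrow> bool" where
  "simplicial_space Y \<longleftrightarrow>
     (\<forall>n i. i \<le> Suc n \<longrightarrow> continuous_map (level Y (Suc n)) (level Y n) (face Y (Suc n) i)) \<and>
     (\<forall>n i. i \<le> n \<longrightarrow> continuous_map (level Y n) (level Y (Suc n)) (degen Y n i)) \<and>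
     (\<forall>n i j. \<forall>x \<in> topspace (level Y (Suc (Suc n))). i < j \<and> j \<le> Suc (Suc n) \<longrightarrow>
        face Y (Suc n) i (face Y (Suc (Suc n)) j x) =
        face Y (Suc n) (j - 1) (face Y (Suc (Suc n)) i x)) \<and>
     (\<forall>n i j. \<forall>x \<in> topspace (level Y n). i \<le> j \<and> j \<le> n \<longrightarrow>
        degen Y (Suc n) i (degen Y n j x) = degen Y (Suc n) (Suc j) (degen Y n i x)) \<and>
     (\<forall>n i j. \<forall>x \<in> topspace (level Y (Suc n)). i < j \<and> j \<le> Suc n \<longrightarrow>
        face Y (Suc (Suc n)) i (degen Y (Suc n) j x) = degen Y n (j - 1) (face Y (Suc n) i x)) \<and>
     (\<forall>n j. \<forall>x \<in> topspace (level Y n). j \<le> n \<longrightarrow>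
        face Y (Suc n) j (degen Y n j x) = x \<and> face Y (Suc n) (Suc j) (degen Y n j x) = x) \<and>
     (\<forall>n i j. \<forall>x \<in> topspace (level Y (Suc n)). Suc j < i \<and> i \<le> Suc (Suc n) \<longrightarrow>
        face Y (Suc (Suc n)) i (degen Y (Suc n) j x) = degen Y n j (face Y (Suc n) (i - 1) x))"

text \<open>\<open>degen_comp Y p [i\<^sub>1, \<dots>, i\<^sub>t]\<close> is $s_{i_1} \cdots s_{i_t}$ from level \<open>p\<close> to level \<open>p + t\<close>
  (the last index acts first); \<open>degen_indices p\<close> says that all indices are in range.\<close>

fun degen_comp :: "'a simplicial \<Rightarrow> nat \<Rightarrow> nat list \<Rightarrow> 'a \<Rightarrow> 'a" where
  "degen_comp Y p [] x = x"
| "degen_comp Y p (i # is) x = degen Y (p + length is) i (degen_comp Y p is x)"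

fun degen_indices :: "nat \<Rightarrow> nat list \<Rightarrow> bool" where
  "degen_indices p [] \<longleftrightarrow> True"
| "degen_indices p (i # is) \<longleftrightarrow> i \<le> p + length is \<and> degen_indices p is"

definition degen_filtration :: "'a simplicial \<Rightarrow> nat \<Rightarrow> nat \<Rightarrow> 'a set" where
  "degen_filtration Y t n =
     (if t \<le> n
      then \<Union>is \<in> {is. length is = t \<and> degen_indices (n - t) is}.
             degen_comp Y (n - t) is ` topspace (level Y (n - t))
      else {})"

text \<open>A sequence $J = (j_r, \dots, j_1)$ is the list \<open>[j\<^sub>r, \<dots>, j\<^sub>1]\<close>, so that $s_J$ is \<open>degen_comp\<close>.\<close>

definition admissible :: "nat \<Rightarrow> nat list \<Rightarrow> bool" where
  "admissible n J \<longleftrightarrow> sorted_wrt (>) J \<and> (\<forall>j \<in> set J. j < n)"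

definition base_at :: "'a simplicial \<Rightarrow> 'a \<Rightarrow> nat \<Rightarrow> 'a" where
  "base_at Y y0 n = degen_comp Y 0 (replicate n 0) y0"


section \<open>Based spaces, quotients, suspensions and wedges\<close>

type_synonym 'a based = "'a topology \<times> 'a"

text \<open>The class of \<open>x\<close> in \<open>Z/B\<close>. If \<open>B\<close> is empty, all classes are singletons and
  \<open>Z/B\<close> is a copy of \<open>Z\<close>.\<close>

definition collapse_class :: "'a set \<Rightarrow> 'a \<Rightarrow> 'a set" where
  "collapse_class B x = (if x \<in> B then B else {x})"

definition collapse_topology :: "'a topology \<Rightarrow> 'a set \<Rightarrow> 'a set topology" where
  "collapse_topology Z B = topology (\<lambda>U. U \<subseteq> collapse_class B ` topspace Z \<and>
      openin Z {x \<in> topspace Z. collapse_class B x \<in> U})"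

lemma istopology_collapse:
  "istopology (\<lambda>U. U \<subseteq> collapse_class B ` topspace Z \<and>
      openin Z {x \<in> topspace Z. collapse_class B x \<in> U})"
proof -
  have 1: "{x \<in> topspace Z. collapse_class B x \<in> S \<inter> T} =
      {x \<in> topspace Z. collapse_class B x \<in> S} \<inter> {x \<in> topspace Z. collapse_class B x \<in> T}"
    for S T by auto
  have 2: "{x \<in> topspace Z. collapse_class B x \<in> \<Union>\<K>} =
      (\<Union>U \<in> \<K>. {x \<in> topspace Z. collapse_class B x \<in> U})" for \<K> by auto
  show ?thesis
    unfolding istopology_def 1 2 by (intro conjI allI impI openin_Int openin_Union) auto
qed

lemma openin_collapse_topology:
  "openin (collapse_topology Z B) U \<longleftrightarrow>
     U \<subseteq> collapse_class B ` topspace Z \<and> openin Z {x \<in> topspace Z. collapse_class B x \<in> U}"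
  by (simp add: collapse_topology_def istopology_collapse)

lemma topspace_collapse_topology [simp]:
  "topspace (collapse_topology Z B) = collapse_class B ` topspace Z"
proof (rule antisym)
  show "topspace (collapse_topology Z B) \<subseteq> collapse_class B ` topspace Z"
    using openin_collapse_topology openin_topspace by blast
  have "{x \<in> topspace Z. collapse_class B x \<in> collapse_class B ` topspace Z} = topspace Z"
    by auto
  then have "openin (collapse_topology Z B) (collapse_class B ` topspace Z)"
    by (simp add: openin_collapse_topology)
  then show "collapse_class B ` topspace Z \<subseteq> topspace (collapse_topology Z B)"
    by (rule openin_subset)
qed

lemma quotient_map_collapse_class:
  "quotient_map Z (collapse_topology Z B) (collapse_class B)"
  by (simp add: quotient_map_def openin_collapse_topology)

text \<open>The quotient of a based space by \<open>B\<close>, based at the class of \<open>B\<close> (or at the original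
  base-point if \<open>B\<close> is empty).\<close>

definition based_quotient :: "'a based \<Rightarrow> 'a set \<Rightarrow> 'a set based" where
  "based_quotient Z B =
     (collapse_topology (fst Z) B, if B = {} then {snd Z} else B)"

definition suspension_collapsed :: "'a based \<Rightarrow> ('a \<times> real) set" where
  "suspension_collapsed Z = topspace (fst Z) \<times> {0, 1} \<union> {snd Z} \<times> {0..1}"

definition reduced_suspension :: "'a based \<Rightarrow> ('a \<times> real) set based" where
  "reduced_suspension Z =
     based_quotient (prod_topology (fst Z) (top_of_set {0..1}), (snd Z, 0)) (suspension_collapsed Z)"

text \<open>The wedge of a family of based spaces, for a nonempty index set.\<close>

definition wedge_collapsed :: "'i set \<Rightarrow> ('i \<Rightarrow> 'a based) \<Rightarrow> ('i \<times> 'a) set" where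
  "wedge_collapsed I F = (\<lambda>i. (i, snd (F i))) ` I"

definition wedge :: "'i set \<Rightarrow> ('i \<Rightarrow> 'a based) \<Rightarrow> ('i \<times> 'a) set based" where
  "wedge I F =
     (collapse_topology (sum_topology (fst \<circ> F) I) (wedge_collapsed I F), wedge_collapsed I F)"

text \<open>The map of quotients induced by a map \<open>f\<close> of the spaces above, \<open>B\<close> being the subspace
  collapsed in the target: it sends the class of \<open>x\<close> to the class of \<open>f x\<close>.\<close>

definition induced_map :: "'b set \<Rightarrow> ('a \<Rightarrow> 'b) \<Rightarrow> 'a set \<Rightarrow> 'b set" where
  "induced_map B f c = the_elem ((\<lambda>x. collapse_class B (f x)) ` c)"

text \<open>The canonical maps $\Sigma A \to \Sigma Z$ for a subspace $A$ of $Z$ with the same base-point,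
  and $\bigvee_{i \in I'} F_i \to \bigvee_{i \in I} F_i$ for $I' \subseteq I$.\<close>

definition suspension_inclusion :: "'a based \<Rightarrow> ('a \<times> real) set \<Rightarrow> ('a \<times> real) set" where
  "suspension_inclusion Z = induced_map (suspension_collapsed Z) (\<lambda>x. x)"

definition wedge_inclusion :: "'i set \<Rightarrow> ('i \<Rightarrow> 'a based) \<Rightarrow> ('i \<times> 'a) set \<Rightarrow> ('i \<times> 'a) set" where
  "wedge_inclusion I F = induced_map (wedge_collapsed I F) (\<lambda>x. x)"

text \<open>Maps and homotopies of based spaces preserve base-points. In particular such a map is
  a homotopy equivalence of the underlying spaces.\<close>

definition based_homotopy_equivalence :: "'a based \<Rightarrow> 'b based \<Rightarrow> ('a \<Rightarrow> 'b) \<Rightarrow> bool" where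
  "based_homotopy_equivalence Z W f \<longleftrightarrow>
     continuous_map (fst Z) (fst W) f \<and> f (snd Z) = snd W \<and>
     (\<exists>g. continuous_map (fst W) (fst Z) g \<and> g (snd W) = snd Z \<and>
        homotopic_with (\<lambda>h. h (snd Z) = snd Z) (fst Z) (fst Z) (g \<circ> f) id \<and>
        homotopic_with (\<lambda>h. h (snd W) = snd W) (fst W) (fst W) (f \<circ> g) id)"

lemma based_homotopy_equivalence_imp_homotopy_equivalent_space:
  "based_homotopy_equivalence Z W f \<Longrightarrow> fst Z homotopy_equivalent_space fst W"
  (is "_ \<Longrightarrow> ?thesis")
proof -
  assume "based_homotopy_equivalence Z W f"
  then obtain g where "continuous_map (fst Z) (fst W) f" "continuous_map (fst W) (fst Z) g"
    and "homotopic_with (\<lambda>h. h (snd Z) = snd Z) (fst Z) (fst Z) (g \<circ> f) id"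
    and "homotopic_with (\<lambda>h. h (snd W) = snd W) (fst W) (fst W) (f \<circ> g) id"
    unfolding based_homotopy_equivalence_def by auto
  moreover from this have "homotopic_with (\<lambda>h. True) (fst Z) (fst Z) (g \<circ> f) id"
    "homotopic_with (\<lambda>h. True) (fst W) (fst W) (f \<circ> g) id"
    by (auto elim: homotopic_with_mono)
  ultimately show ?thesis
    unfolding homotopy_equivalent_space_def by blast
qed


section \<open>The pieces of a simplicial space\<close>

definition level_space :: "'a simplicial \<Rightarrow> 'a \<Rightarrow> nat \<Rightarrow> 'a based" where
  "level_space Y y0 n = (level Y n, base_at Y y0 n)"

definition filtration_space :: "'a simplicial \<Rightarrow> 'a \<Rightarrow> nat \<Rightarrow> nat \<Rightarrow> 'a based" where
  "filtration_space Y y0 n t =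
     (subtopology (level Y n) (degen_filtration Y t n), base_at Y y0 n)"

definition filtration_quotient :: "'a simplicial \<Rightarrow> 'a \<Rightarrow> nat \<Rightarrow> nat \<Rightarrow> 'a set based" where
  "filtration_quotient Y y0 n r =
     based_quotient (filtration_space Y y0 n r) (degen_filtration Y (Suc r) n)"

text \<open>The quotient of $s_J(Y_{n-r})$ by $s_J(S(Y_{n-r}))$, where $r = |J|$.\<close>

definition degen_quotient :: "'a simplicial \<Rightarrow> 'a \<Rightarrow> nat \<Rightarrow> nat list \<Rightarrow> 'a set based" where
  "degen_quotient Y y0 n J =
     (let p = n - length J; s = degen_comp Y p J in
      based_quotient (subtopology (level Y n) (s ` topspace (level Y p)), base_at Y y0 n)
        (s ` degen_filtration Y 1 p))"

definition admissible_wedge ::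
    "'a simplicial \<Rightarrow> 'a \<Rightarrow> nat \<Rightarrow> nat \<Rightarrow> (nat list \<times> ('a set \<times> real) set) set based" where
  "admissible_wedge Y y0 n r =
     wedge {J. admissible n J \<and> length J = r} (\<lambda>J. reduced_suspension (degen_quotient Y y0 n J))"


section \<open>The simplicial space of an abstract simplicial complex\<close>

definition Delta :: "nat set set \<Rightarrow> nat list simplicial" where
  "Delta K =
     \<lparr> level = (\<lambda>n. discrete_topology {v. length v = Suc n \<and> sorted v \<and> set v \<in> K}),
       face = (\<lambda>n i v. take i v @ drop (Suc i) v),
       degen = (\<lambda>n i v. take (Suc i) v @ drop i v) \<rparr>"

lemma Delta_face_closed:
  assumes "abstract_simplicial_complex m K" "i \<le> Suc n"
    and "length v = Suc (Suc n)" "sorted v" "set v \<in> K"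
  shows "sorted (take i v @ drop (Suc i) v)" "set (take i v @ drop (Suc i) v) \<in> K"
proof -
  have "sorted (take i v @ drop i v)"
    using assms(4) by simp
  moreover have "drop i v = v ! i # drop (Suc i) v"
    using assms by (simp add: Cons_nth_drop_Suc)
  ultimately show "sorted (take i v @ drop (Suc i) v)"
    by (simp add: sorted_append)
  have "set (take i v @ drop (Suc i) v) \<subseteq> set v"
    using set_take_subset[of i v] set_drop_subset[of "Suc i" v] by simp
  moreover have "length (take i v @ drop (Suc i) v) = Suc n"
    using assms by simp
  then have "set (take i v @ drop (Suc i) v) \<noteq> {}"
    by (metis length_0_conv nat.distinct(1) set_empty)
  ultimately show "set (take i v @ drop (Suc i) v) \<in> K"
    using assms(1,5) unfolding abstract_simplicial_complex_def by blast
qed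

lemma Delta_degen_closed:
  assumes "i < length v" "sorted v"
  shows "sorted (take (Suc i) v @ drop i v)" "set (take (Suc i) v @ drop i v) = set v"
proof -
  have d: "drop i v = v ! i # drop (Suc i) v"
    using assms by (simp add: Cons_nth_drop_Suc)
  have t: "take (Suc i) v = take i v @ [v ! i]"
    using assms by (simp add: take_Suc_conv_app_nth)
  have v: "v = take i v @ v ! i # drop (Suc i) v"
    using d by (metis append_take_drop_id)
  have "sorted (take i v @ v ! i # drop (Suc i) v)"
    using assms(2) v by simp
  then show "sorted (take (Suc i) v @ drop i v)"
    unfolding d t by (auto simp: sorted_append)
  have "set v = set (take i v @ v ! i # drop (Suc i) v)"
    using v by simp
  then show "set (take (Suc i) v @ drop i v) = set v"
    unfolding d t by auto
qed

lemma simplicial_space_Delta: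
  assumes "abstract_simplicial_complex m K"
  shows "simplicial_space (Delta K)"
  unfolding simplicial_space_def
proof (intro conjI allI ballI impI; (elim conjE)?)
  fix n i :: nat assume "i \<le> Suc n"
  then show "continuous_map (level (Delta K) (Suc n)) (level (Delta K) n) (face (Delta K) (Suc n) i)"
    using Delta_face_closed[OF assms] by (simp add: Delta_def Pi_iff)
next
  fix n i :: nat assume "i \<le> n"
  then have "sorted (take (Suc i) v @ drop i v)" "set (take (Suc i) v @ drop i v) \<in> K"
    if "length v = Suc n" "sorted v" "set v \<in> K" for v
    using Delta_degen_closed[of i v] that by (auto simp only: less_Suc_eq_le)
  then show "continuous_map (level (Delta K) n) (level (Delta K) (Suc n)) (degen (Delta K) n i)"
    using \<open>i \<le> n\<close> by (simp add: Delta_def Pi_iff)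
qed (auto simp: Delta_def nth_append min_def not_less split: if_splits
       intro!: nth_equalityI arg_cong[where f = "nth _"])

end

theory Submission
  imports Defs
begin

text \<open>The spaces $Y_n$ are discrete, so all spaces in the theorem are bouquets of circles:
  suspensions of based discrete sets, and wedges of such. Two bouquets are equivalent as soon as
  their circles correspond. A tuple \<open>v\<close> in $Y_n$ is determined by the strictly increasing tuple of
  its distinct entries and the set of positions $i$ with $v_i = v_{i+1}$, and the descending list of
  these positions is the unique admissible $J$ for which \<open>v\<close> lies in $s_J(Y_{n-r})$ but not in
  $s_J(S(Y_{n-r}))$. So sending \<open>v\<close> to itself in the summand of $r = |J|$, respectively of $J$,
  is a bijection of circles away from the base-point, and it is compatible with the filtration.\<close>

section \<open>Bouquets of circles\<close>

text \<open>\<open>q a\<close> is the loop of the circle with label \<open>a\<close>. Several labels (those in \<open>A0\<close>) may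
  carry the constant loop; this allows the labels of a quotient or of a wedge to be the
  points before identification.\<close>

definition bouquet :: "'a set \<Rightarrow> 'a set \<Rightarrow> 'b based \<Rightarrow> ('a \<Rightarrow> real \<Rightarrow> 'b) \<Rightarrow> bool" where
  "bouquet A A0 Z q \<longleftrightarrow>
     A0 \<subseteq> A \<and> A0 \<noteq> {} \<and>
     topspace (fst Z) = (\<Union>a\<in>A. q a ` {0..1}) \<and>
     (\<forall>U \<subseteq> topspace (fst Z). openin (fst Z) U \<longleftrightarrow>
        (\<forall>a\<in>A. openin (top_of_set {0..1}) {s \<in> {0..1}. q a s \<in> U})) \<and>
     (\<forall>a\<in>A. \<forall>s\<in>{0..1}. q a s = snd Z \<longleftrightarrow> a \<in> A0 \<or> s = 0 \<or> s = 1) \<and>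
     (\<forall>a\<in>A. \<forall>a'\<in>A. \<forall>s\<in>{0..1}. \<forall>s'\<in>{0..1}.
        q a s = q a' s' \<longrightarrow> q a s = snd Z \<or> a = a' \<and> s = s')"

lemma bouquet_base:
  assumes "bouquet A A0 Z q"
  shows "A0 \<subseteq> A" "A0 \<noteq> {}"
  using assms unfolding bouquet_def by simp_all

lemma bouquet_topspace: "bouquet A A0 Z q \<Longrightarrow> topspace (fst Z) = (\<Union>a\<in>A. q a ` {0..1})"
  by (simp add: bouquet_def)

lemma bouquet_openin:
  "bouquet A A0 Z q \<Longrightarrow> U \<subseteq> topspace (fst Z) \<Longrightarrow>
     openin (fst Z) U \<longleftrightarrow> (\<forall>a\<in>A. openin (top_of_set {0..1}) {s \<in> {0..1}. q a s \<in> U})"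
  unfolding bouquet_def by blast

lemma bouquet_eq_base:
  "bouquet A A0 Z q \<Longrightarrow> a \<in> A \<Longrightarrow> s \<in> {0..1} \<Longrightarrow> q a s = snd Z \<longleftrightarrow> a \<in> A0 \<or> s = 0 \<or> s = 1"
  unfolding bouquet_def by blast

lemma bouquet_cancel:
  "bouquet A A0 Z q \<Longrightarrow> a \<in> A \<Longrightarrow> a' \<in> A \<Longrightarrow> s \<in> {0..1} \<Longrightarrow> s' \<in> {0..1} \<Longrightarrow>
     q a s = q a' s' \<Longrightarrow> q a s = snd Z \<or> a = a' \<and> s = s'"
  unfolding bouquet_def by blast

lemma bouquet_in_topspace:
  "bouquet A A0 Z q \<Longrightarrow> a \<in> A \<Longrightarrow> s \<in> {0..1} \<Longrightarrow> q a s \<in> topspace (fst Z)"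
  unfolding bouquet_topspace by blast

text \<open>Labels may be pulled back along \<open>h\<close> because distinct new labels are
  identified only where their common image carries the constant loop, so cancellation away from the
  base-point survives. With \<open>h\<close> a collapse map this yields the labels of a
  quotient.\<close>

lemma bouquet_relabel:
  assumes "bouquet A A0 Z q" and "h ` P = A"
    and inj: "\<And>x y. x \<in> P \<Longrightarrow> y \<in> P \<Longrightarrow> h x = h y \<Longrightarrow> x = y \<or> h x \<in> A0"
  shows "bouquet P {x \<in> P. h x \<in> A0} Z (\<lambda>x. q (h x))"
  unfolding bouquet_def
proof (intro conjI allI ballI impI)
  show "{x \<in> P. h x \<in> A0} \<noteq> {}"
    using bouquet_base[OF assms(1)] assms(2) by blast
  show "topspace (fst Z) = (\<Union>x\<in>P. q (h x) ` {0..1})"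
    using bouquet_topspace[OF assms(1)] assms(2) by blast
next
  fix U assume "U \<subseteq> topspace (fst Z)"
  then show "openin (fst Z) U \<longleftrightarrow>
      (\<forall>x\<in>P. openin (top_of_set {0..1}) {s \<in> {0..1}. q (h x) s \<in> U})"
    using bouquet_openin[OF assms(1)] assms(2) by blast
next
  fix x s assume "x \<in> P" "s \<in> {0..1::real}"
  then show "q (h x) s = snd Z \<longleftrightarrow> x \<in> {x \<in> P. h x \<in> A0} \<or> s = 0 \<or> s = 1"
    using bouquet_eq_base[OF assms(1), of "h x" s] assms(2) by blast
next
  fix x y s s' assume *: "x \<in> P" "y \<in> P" "s \<in> {0..1::real}" "s' \<in> {0..1::real}"
    "q (h x) s = q (h y) s'"
  then have "h x \<in> A" "h y \<in> A" using assms(2) by auto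
  then show "q (h x) s = snd Z \<or> x = y \<and> s = s'"
    using bouquet_cancel[OF assms(1) _ _ *(3-5)] inj[OF *(1,2)]
      bouquet_eq_base[OF assms(1), of "h x" s] *(3) by blast
qed auto

section \<open>Suspensions of based discrete sets and of their quotients\<close>

text \<open>A product with a discrete factor is the disjoint union of its slices \<open>{a}\<close>
  times \<open>T\<close>, and each slice is open.\<close>

lemma openin_prod_discrete:
  assumes "S \<subseteq> A \<times> topspace T"
  shows "openin (prod_topology (discrete_topology A) T) S \<longleftrightarrow>
           (\<forall>a\<in>A. openin T {s \<in> topspace T. (a, s) \<in> S})"
proof (intro iffI ballI)
  fix a assume "openin (prod_topology (discrete_topology A) T) S" "a \<in> A"
  moreover from this have "continuous_map T (prod_topology (discrete_topology A) T) (\<lambda>s. (a, s))"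
    by (intro continuous_map_pairedI) auto
  ultimately show "openin T {s \<in> topspace T. (a, s) \<in> S}"
    by (simp add: openin_continuous_map_preimage)
next
  assume *: "\<forall>a\<in>A. openin T {s \<in> topspace T. (a, s) \<in> S}"
  have "S = (\<Union>a\<in>A. {a} \<times> {s \<in> topspace T. (a, s) \<in> S})"
    using assms by auto
  moreover have "openin (prod_topology (discrete_topology A) T)
      (\<Union>a\<in>A. {a} \<times> {s \<in> topspace T. (a, s) \<in> S})"
    using * by (intro openin_Union) (auto simp: openin_prod_Times_iff)
  ultimately show "openin (prod_topology (discrete_topology A) T) S"
    by simp
qed

lemma collapse_class_eq_self_iff: "collapse_class B x = B \<longleftrightarrow> x \<in> B"
  by (auto simp: collapse_class_def)

lemma collapse_class_eq_iff:
  "collapse_class B x = collapse_class B y \<longleftrightarrow> x = y \<or> x \<in> B \<and> y \<in> B"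
  by (auto simp: collapse_class_def)

text \<open>Every class for \<open>B\<close> lies inside a single class for \<open>B'\<close>, so
  the image under \<open>collapse_class B'\<close> is a singleton and \<open>the_elem\<close> in
  \<open>induced_map\<close> is meaningful. This evaluates the canonical inclusions of suspensions
  and wedges.\<close>

lemma induced_map_id:
  assumes "B \<subseteq> B'"
  shows "induced_map B' (\<lambda>x. x) (collapse_class B x) = collapse_class B' x"
proof -
  have "collapse_class B' ` collapse_class B x = {collapse_class B' x}"
    using assms by (auto simp: collapse_class_def)
  then show ?thesis
    by (simp add: induced_map_def)
qed

definition susp_class :: "'a based \<Rightarrow> 'a \<Rightarrow> real \<Rightarrow> ('a \<times> real) set" where
  "susp_class Z a s = collapse_class (suspension_collapsed Z) (a, s)"

text \<open>Each point of the discrete set contributes one copy of the unit interval. The suspension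
  glues all endpoints together and crushes the whole interval over the base-point, which is
  therefore the only label with a constant loop.\<close>

lemma bouquet_suspension:
  assumes "fst Z = discrete_topology A" "snd Z \<in> A"
  shows "bouquet A {snd Z} (reduced_suspension Z) (susp_class Z)"
proof -
  let ?C = "suspension_collapsed Z"
  have C: "?C = A \<times> {0, 1} \<union> {snd Z} \<times> {0..1}"
    using assms by (simp add: suspension_collapsed_def)
  \<comment> \<open>Nonemptiness selects the branch of \<open>based_quotient\<close> in which the
    base-point is the collapsed class itself.\<close>
  then have ne: "?C \<noteq> {}" using assms(2) by auto
  let ?R = "reduced_suspension Z"
  have b: "snd ?R = ?C"
    using ne by (simp add: reduced_suspension_def based_quotient_def)
  have f: "fst ?R = collapse_topology (prod_topology (discrete_topology A) (top_of_set {0..1})) ?C"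
    using assms by (simp add: reduced_suspension_def based_quotient_def)
  have ts: "topspace (fst ?R) = collapse_class ?C ` (A \<times> {0..1})"
    by (simp add: f)
  show ?thesis
    unfolding bouquet_def
  proof (intro conjI allI ballI impI)
    show "topspace (fst ?R) = (\<Union>a\<in>A. susp_class Z a ` {0..1})"
      by (auto simp: ts susp_class_def)
  next
    fix U assume U: "U \<subseteq> topspace (fst ?R)"
    have "openin (fst ?R) U \<longleftrightarrow> openin (prod_topology (discrete_topology A) (top_of_set {0..1}))
        {x \<in> A \<times> {0..1}. collapse_class ?C x \<in> U}"
      using U by (simp add: f openin_collapse_topology)
    also have "\<dots> \<longleftrightarrow> (\<forall>a\<in>A. openin (top_of_set {0..1}) {s \<in> {0..1}. susp_class Z a s \<in> U})"
      by (subst openin_prod_discrete) (auto simp: susp_class_def intro!: ball_cong arg_cong[where f="openin _"])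
    finally show "openin (fst ?R) U \<longleftrightarrow>
        (\<forall>a\<in>A. openin (top_of_set {0..1}) {s \<in> {0..1}. susp_class Z a s \<in> U})" .
  next
    fix a s assume "a \<in> A" "s \<in> {0..1::real}"
    then show "susp_class Z a s = snd ?R \<longleftrightarrow> a \<in> {snd Z} \<or> s = 0 \<or> s = 1"
      unfolding b susp_class_def collapse_class_eq_self_iff C by auto
  next
    fix a a' s s' assume "susp_class Z a s = susp_class Z a' s'"
    then show "susp_class Z a s = snd ?R \<or> a = a' \<and> s = s'"
      unfolding b susp_class_def by (auto simp: collapse_class_eq_iff collapse_class_eq_self_iff)
  qed (use assms in auto)
qed

lemma collapse_discrete_topology:
  "collapse_topology (discrete_topology P) B = discrete_topology (collapse_class B ` P)"
  by (rule topology_eq[THEN iffD2]) (auto simp: openin_collapse_topology)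

text \<open>The suspension of the quotient is a bouquet labelled by classes; relabelling along
  \<open>collapse_class B\<close> makes the points of \<open>P\<close> the labels. Inserting
  \<open>b\<close> matters when \<open>B\<close> is empty, for then \<open>b\<close> alone carries
  the constant loop.\<close>

lemma bouquet_suspension_quotient:
  assumes "Z = (discrete_topology P, b)" and "b \<in> P" "B \<subseteq> P" "B \<noteq> {} \<Longrightarrow> b \<in> B"
  shows "bouquet P (insert b B) (reduced_suspension (based_quotient Z B))
           (\<lambda>x. susp_class (based_quotient Z B) (collapse_class B x))"
proof -
  let ?Q = "based_quotient Z B"
  \<comment> \<open>For empty \<open>B\<close> the base-point is the class \<open>{b}\<close>;
    otherwise it is \<open>B\<close>, which already contains \<open>b\<close>.\<close>
  have base: "collapse_class B x = snd ?Q \<longleftrightarrow> x = b \<or> x \<in> B" for x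
    using assms by (auto simp: based_quotient_def collapse_class_def)
  have "bouquet (collapse_class B ` P) {snd ?Q} (reduced_suspension ?Q) (susp_class ?Q)"
  proof (rule bouquet_suspension)
    show "fst ?Q = discrete_topology (collapse_class B ` P)"
      by (simp add: assms(1) based_quotient_def collapse_discrete_topology)
    show "snd ?Q \<in> collapse_class B ` P"
      using base assms(2) by blast
  qed
  then have "bouquet P {x \<in> P. collapse_class B x \<in> {snd ?Q}} (reduced_suspension ?Q)
      (\<lambda>x. susp_class ?Q (collapse_class B x))"
    by (rule bouquet_relabel) (auto simp: base collapse_class_eq_iff)
  moreover have "{x \<in> P. collapse_class B x \<in> {snd ?Q}} = insert b B"
    using base assms(2,3) by auto
  ultimately show ?thesis by simp
qed

section \<open>Wedges of bouquets\<close>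

definition wedge_class ::
    "'i set \<Rightarrow> ('i \<Rightarrow> 'b based) \<Rightarrow> ('i \<Rightarrow> 'a \<Rightarrow> real \<Rightarrow> 'b) \<Rightarrow> 'i \<times> 'a \<Rightarrow> real \<Rightarrow> ('i \<times> 'b) set" where
  "wedge_class I F q = (\<lambda>(i, a) s. collapse_class (wedge_collapsed I F) (i, q i a s))"

text \<open>A circle of the wedge is a circle of one summand, so its label is the pair of summand
  index and label there. Openness is tested first on the summands and then along their loops. Since
  the conclusion is again a bouquet, the lemma can be iterated for nested wedges.\<close>

lemma bouquet_wedge:
  assumes bq: "\<And>i. i \<in> I \<Longrightarrow> bouquet (A i) (A0 i) (F i) (q i)" and "I \<noteq> {}"
  shows "bouquet (Sigma I A) (Sigma I A0) (wedge I F) (wedge_class I F q)"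
proof -
  let ?C = "wedge_collapsed I F"
  let ?W = "wedge I F"
  have C: "(i, x) \<in> ?C \<longleftrightarrow> i \<in> I \<and> x = snd (F i)" for i x
    by (auto simp: wedge_collapsed_def)
  have b: "snd ?W = ?C" by (simp add: wedge_def)
  have f: "fst ?W = collapse_topology (sum_topology (fst \<circ> F) I) ?C" by (simp add: wedge_def)
  have ts: "topspace (fst ?W) = collapse_class ?C ` (SIGMA i:I. topspace (fst (F i)))"
    by (simp add: f o_def)
  show ?thesis
    unfolding bouquet_def
  proof (intro conjI allI ballI impI)
    show "Sigma I A0 \<subseteq> Sigma I A" "Sigma I A0 \<noteq> {}"
      using bouquet_base[OF bq] assms(2) by blast+
    show "topspace (fst ?W) = (\<Union>a\<in>Sigma I A. wedge_class I F q a ` {0..1})"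
    proof -
      have "(SIGMA i:I. topspace (fst (F i))) = (SIGMA i:I. \<Union>a\<in>A i. q i a ` {0..1})"
        by (rule Sigma_cong) (auto simp only: bouquet_topspace[OF bq])
      also have "\<dots> = (\<Union>i\<in>I. \<Union>a\<in>A i. (\<lambda>s. (i, q i a s)) ` {0..1})"
        by blast
      finally have "topspace (fst ?W) =
          (\<Union>i\<in>I. \<Union>a\<in>A i. (\<lambda>s. collapse_class ?C (i, q i a s)) ` {0..1})"
        by (simp only: ts image_UN image_image)
      also have "\<dots> = (\<Union>a\<in>Sigma I A. wedge_class I F q a ` {0..1})"
        by (auto simp: wedge_class_def simp del: atLeastAtMost_iff)
      finally show ?thesis .
    qed
  next
    fix U assume U: "U \<subseteq> topspace (fst ?W)"
    have "openin (fst ?W) U \<longleftrightarrow> openin (sum_topology (fst \<circ> F) I)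
        {x \<in> (SIGMA i:I. topspace (fst (F i))). collapse_class ?C x \<in> U}"
      using U by (simp add: f openin_collapse_topology o_def)
    also have "\<dots> \<longleftrightarrow> (\<forall>i\<in>I. openin (fst (F i))
        {x \<in> topspace (fst (F i)). collapse_class ?C (i, x) \<in> U})"
      by (auto simp: openin_sum_topology intro!: ball_cong arg_cong[where f="openin _"])
    also have "\<dots> \<longleftrightarrow> (\<forall>i\<in>I. \<forall>a\<in>A i. openin (top_of_set {0..1})
        {s \<in> {0..1}. collapse_class ?C (i, q i a s) \<in> U})"
    proof (intro ball_cong refl)
      fix i assume i: "i \<in> I"
      have "{s \<in> {0..1}. q i a s \<in> {x \<in> topspace (fst (F i)). collapse_class ?C (i, x) \<in> U}} =
          {s \<in> {0..1}. collapse_class ?C (i, q i a s) \<in> U}" if "a \<in> A i" for a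
        using bouquet_in_topspace[OF bq[OF i] that] by auto
      then show "openin (fst (F i)) {x \<in> topspace (fst (F i)). collapse_class ?C (i, x) \<in> U} \<longleftrightarrow>
          (\<forall>a\<in>A i. openin (top_of_set {0..1})
             {s \<in> {0..1}. collapse_class ?C (i, q i a s) \<in> U})"
        by (subst bouquet_openin[OF bq[OF i]]) auto
    qed
    finally show "openin (fst ?W) U \<longleftrightarrow> (\<forall>a\<in>Sigma I A.
        openin (top_of_set {0..1}) {s \<in> {0..1}. wedge_class I F q a s \<in> U})"
      by (simp add: wedge_class_def)
  next
    fix a s assume *: "a \<in> Sigma I A" "s \<in> {0..1::real}"
    then obtain i x where ix: "a = (i, x)" "i \<in> I" "x \<in> A i" by blast
    then show "wedge_class I F q a s = snd ?W \<longleftrightarrow> a \<in> Sigma I A0 \<or> s = 0 \<or> s = 1"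
      using bouquet_eq_base[OF bq[OF ix(2)] ix(3) *(2)]
      by (simp add: b wedge_class_def collapse_class_eq_self_iff C)
  next
    fix a a' s s'
    assume *: "a \<in> Sigma I A" "a' \<in> Sigma I A" "s \<in> {0..1::real}" "s' \<in> {0..1::real}"
      "wedge_class I F q a s = wedge_class I F q a' s'"
    obtain i x j y where ix: "a = (i, x)" "i \<in> I" "x \<in> A i" and jy: "a' = (j, y)" "j \<in> I" "y \<in> A j"
      using *(1,2) by blast
    have "i = j \<and> q i x s = q j y s' \<or> (i, q i x s) \<in> ?C"
      using *(5) by (auto simp: ix jy wedge_class_def collapse_class_eq_iff)
    \<comment> \<open>Classes agree either because the points agree within one summand, where
      cancellation in that bouquet applies, or because both points are base-points.\<close>
    then consider "i = j" "q i x s = q i y s'" | "(i, q i x s) \<in> ?C" by blast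
    then have "(i, q i x s) \<in> ?C \<or> i = j \<and> x = y \<and> s = s'"
    proof cases
      case 1
      then have "y \<in> A i" using jy by simp
      from bouquet_cancel[OF bq[OF ix(2)] ix(3) this *(3,4) 1(2)] show ?thesis
        using 1(1) ix(2) by (auto simp only: C)
    qed blast
    then show "wedge_class I F q a s = snd ?W \<or> a = a' \<and> s = s'"
      by (simp add: ix jy b wedge_class_def collapse_class_eq_self_iff)
  qed
qed

section \<open>Maps and equivalences induced by maps of labels\<close>

text \<open>A map of labels sends each circle to a circle at the same parameter. It is well defined
  since constant loops go to constant loops, and continuous since openness is tested along the
  loops.\<close>

lemma bouquet_map:
  assumes Z: "bouquet A A0 Z q" and W: "bouquet B B0 W p"
    and \<phi>: "\<And>a. a \<in> A \<Longrightarrow> \<phi> a \<in> B" "\<And>a. a \<in> A0 \<Longrightarrow> \<phi> a \<in> B0"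
  shows "\<exists>f. continuous_map (fst Z) (fst W) f \<and> f (snd Z) = snd W \<and>
    (\<forall>a\<in>A. \<forall>s\<in>{0..1}. f (q a s) = p (\<phi> a) s)"
proof -
  define f where "f z = (case SOME (a, s). a \<in> A \<and> s \<in> {0..1} \<and> z = q a s of (a, s) \<Rightarrow> p (\<phi> a) s)" for z
  have f: "f (q a s) = p (\<phi> a) s" if "a \<in> A" "s \<in> {0..1}" for a s
  proof -
    obtain a' s' where e: "(SOME (a', s'). a' \<in> A \<and> s' \<in> {0..1} \<and> q a s = q a' s') = (a', s')"
      by (rule prod.exhaust)
    have "(case (SOME (a', s'). a' \<in> A \<and> s' \<in> {0..1} \<and> q a s = q a' s') of
        (a', s') \<Rightarrow> a' \<in> A \<and> s' \<in> {0..1} \<and> q a s = q a' s')"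
      by (rule someI[where x = "(a, s)"]) (use that in simp)
    then have *: "a' \<in> A" "s' \<in> {0..1}" "q a s = q a' s'"
      unfolding e by auto
    \<comment> \<open>Independence of the representation chosen by \<open>SOME\<close>: it is unique
      away from the base-point, and over the base-point both values are
      \<open>snd W\<close>.\<close>
    have "p (\<phi> a') s' = p (\<phi> a) s"
    proof (cases "q a s = snd Z")
      case True
      then have "a \<in> A0 \<or> s = 0 \<or> s = 1" "a' \<in> A0 \<or> s' = 0 \<or> s' = 1"
        using bouquet_eq_base[OF Z] that * by auto
      then have "p (\<phi> a) s = snd W" "p (\<phi> a') s' = snd W"
        using bouquet_eq_base[OF W] \<phi> that * by auto
      then show ?thesis by simp
    next
      case False
      then show ?thesis using bouquet_cancel[OF Z] that * by blast
    qed
    then show ?thesis unfolding f_def e by simp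
  qed
  obtain a0 where a0: "a0 \<in> A0" "a0 \<in> A" using bouquet_base[OF Z] by blast
  have "f (snd Z) = p (\<phi> a0) 0"
    using f[OF a0(2), of 0] bouquet_eq_base[OF Z a0(2), of 0] by simp
  also have "\<dots> = snd W"
    using bouquet_eq_base[OF W \<phi>(1)[OF a0(2)], of 0] by simp
  finally have base: "f (snd Z) = snd W" .
  have "continuous_map (fst Z) (fst W) f"
    unfolding continuous_map_def
  proof (intro conjI allI impI)
    show "f \<in> topspace (fst Z) \<rightarrow> topspace (fst W)"
      using f \<phi>(1) by (auto simp: bouquet_topspace[OF Z] intro!: bouquet_in_topspace[OF W])
    fix U assume U: "openin (fst W) U"
    have "{s \<in> {0..1}. q a s \<in> {z \<in> topspace (fst Z). f z \<in> U}} = {s \<in> {0..1}. p (\<phi> a) s \<in> U}"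
      if "a \<in> A" for a
      using f[OF that] bouquet_in_topspace[OF Z that] by auto
    then show "openin (fst Z) {z \<in> topspace (fst Z). f z \<in> U}"
      using U bouquet_openin[OF W openin_subset[OF U]] \<phi>(1)
      by (subst bouquet_openin[OF Z]) auto
  qed
  then show ?thesis using base f by blast
qed

text \<open>Only the labels outside \<open>A0\<close> and \<open>B0\<close> carry genuine circles,
  so a bijection between these gives mutually inverse based maps. The formula for \<open>f\<close>
  on loops is retained so that maps built for different spaces can be compared.\<close>

lemma bouquet_equivalence:
  assumes Z: "bouquet A A0 Z q" and W: "bouquet B B0 W p"
    and \<phi>: "\<And>a. a \<in> A0 \<Longrightarrow> \<phi> a \<in> B0" "bij_betw \<phi> (A - A0) (B - B0)"
  shows "\<exists>f. based_homotopy_equivalence Z W f \<and> (\<forall>a\<in>A. \<forall>s\<in>{0..1}. f (q a s) = p (\<phi> a) s)"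
proof -
  note sub = bouquet_base(1)[OF Z] bouquet_base(1)[OF W]
  obtain a0 where a0: "a0 \<in> A0"
    using bouquet_base(2)[OF Z] by blast
  note img = bij_betw_imp_surj_on[OF \<phi>(2)] and inj = bij_betw_imp_inj_on[OF \<phi>(2)]
  have \<phi>A: "\<phi> a \<in> B" if "a \<in> A" for a
    using that \<phi>(1) img sub by (cases "a \<in> A0") blast+
  \<comment> \<open>All labels in \<open>B0\<close> carry the constant loop, so any fixed
    \<open>a0\<close> in \<open>A0\<close> serves as their image.\<close>
  define \<psi> where "\<psi> b = (if b \<in> B0 then a0 else inv_into (A - A0) \<phi> b)" for b
  have \<psi>_in: "\<psi> b \<in> A - A0" "\<phi> (\<psi> b) = b" if "b \<in> B - B0" for b
  proof -
    have "b \<in> \<phi> ` (A - A0)" using that img by simp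
    then show "\<psi> b \<in> A - A0" "\<phi> (\<psi> b) = b"
      using that inv_into_into[of b \<phi> "A - A0"] f_inv_into_f[of b \<phi> "A - A0"]
      unfolding \<psi>_def by simp_all
  qed
  have \<psi>_\<phi>: "\<psi> (\<phi> a) = a" if "a \<in> A - A0" for a
  proof -
    have "\<phi> a \<notin> B0" using that img by blast
    then show ?thesis using inv_into_f_f[OF inj that] by (simp add: \<psi>_def)
  qed
  have \<psi>B0: "\<psi> b \<in> A0" if "b \<in> B0" for b
    using that a0 by (simp add: \<psi>_def)
  have \<psi>B: "\<psi> b \<in> A" if "b \<in> B" for b
    using that \<psi>B0 \<psi>_in sub by (cases "b \<in> B0") auto
  obtain f where f: "continuous_map (fst Z) (fst W) f" "f (snd Z) = snd W"
    "\<forall>a\<in>A. \<forall>s\<in>{0..1}. f (q a s) = p (\<phi> a) s"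
    using bouquet_map[OF Z W, of \<phi>] \<phi>A \<phi>(1) by blast
  obtain g where g: "continuous_map (fst W) (fst Z) g" "g (snd W) = snd Z"
    "\<forall>b\<in>B. \<forall>s\<in>{0..1}. g (p b s) = q (\<psi> b) s"
    using bouquet_map[OF W Z, of \<psi>] \<psi>B \<psi>B0 by blast
  have gf: "g (f z) = z" if z: "z \<in> topspace (fst Z)" for z
  proof -
    obtain a s where as: "a \<in> A" "s \<in> {0..1}" "z = q a s"
      using z unfolding bouquet_topspace[OF Z] by blast
    show ?thesis
    proof (cases "a \<in> A0")
      case True
      then have "z = snd Z" using bouquet_eq_base[OF Z as(1,2)] as by simp
      then show ?thesis using f(2) g(2) by simp
    next
      case False
      then show ?thesis using f(3) g(3) \<phi>A \<psi>_\<phi> as by simp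
    qed
  qed
  have fg: "f (g w) = w" if w: "w \<in> topspace (fst W)" for w
  proof -
    obtain b s where bs: "b \<in> B" "s \<in> {0..1}" "w = p b s"
      using w unfolding bouquet_topspace[OF W] by blast
    show ?thesis
    proof (cases "b \<in> B0")
      case True
      then have "w = snd W" using bouquet_eq_base[OF W bs(1,2)] bs by simp
      then show ?thesis using f(2) g(2) by simp
    next
      case False
      then show ?thesis using f(3) g(3) \<psi>B \<psi>_in(2) bs by simp
    qed
  qed
  \<comment> \<open>The composites are the identity on the spaces, so constant homotopies
    suffice.\<close>
  have "based_homotopy_equivalence Z W f"
    unfolding based_homotopy_equivalence_def
  proof (intro conjI exI[of _ g])
    show "homotopic_with (\<lambda>h. h (snd Z) = snd Z) (fst Z) (fst Z) (g \<circ> f) id"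
      using f(2) g(2) gf continuous_map_compose[OF f(1) g(1)]
      by (intro homotopic_with_equal) simp_all
    show "homotopic_with (\<lambda>h. h (snd W) = snd W) (fst W) (fst W) (f \<circ> g) id"
      using f(2) g(2) fg continuous_map_compose[OF g(1) f(1)]
      by (intro homotopic_with_equal) simp_all
  qed (fact f g)+
  then show ?thesis using f(3) by blast
qed


section \<open>Degeneracies of ordered tuples\<close>

text \<open>For an ordered tuple these are the indices $i$ for which it lies in the image of
  $s_i$.\<close>

definition repetitions :: "'a list \<Rightarrow> nat set" where
  "repetitions v = {i. Suc i < length v \<and> v ! i = v ! Suc i}"

lemma repetitions_subset: "repetitions v \<subseteq> {..<length v - 1}"
  by (auto simp: repetitions_def)

lemma finite_repetitions [simp]: "finite (repetitions v)"
  using repetitions_subset finite_subset by blast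

text \<open>Doubling entry \<open>i\<close> leaves the entries up to \<open>i\<close> in place and
  shifts those from \<open>i\<close> on by one. Repetitions before \<open>i\<close> thus stay, the
  others move up by one, and a new one appears at \<open>i\<close>.\<close>

lemma repetitions_degen:
  assumes "i < length v"
  shows "repetitions (take (Suc i) v @ drop i v) =
           insert i ((\<lambda>j. if j < i then j else Suc j) ` repetitions v)"
    (is "repetitions ?w = insert i (?\<sigma> ` _)")
proof -
  have len: "length ?w = Suc (length v)" using assms by simp
  have lo: "?w ! j = v ! j" if "j \<le> i" for j
    using that assms by (auto simp: nth_append min_def)
  have hi: "?w ! Suc j = v ! j" if "i \<le> j" "j < length v" for j
    using that assms by (simp add: nth_append min_absorb2 Suc_le_eq)
  have i: "i \<in> repetitions ?w"
    using assms lo[of i] hi[of i] by (simp add: repetitions_def)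
  have below: "j \<in> repetitions ?w \<longleftrightarrow> j \<in> repetitions v" if "j < i" for j
    using that assms lo[of j] lo[of "Suc j"] unfolding repetitions_def len by auto
  have above: "Suc j \<in> repetitions ?w \<longleftrightarrow> j \<in> repetitions v" if "i \<le> j" for j
    using that hi[of j] hi[of "Suc j"] unfolding repetitions_def mem_Collect_eq len by auto
  show ?thesis
  proof (rule set_eqI)
    fix k
    consider "k < i" | "k = i" | j where "k = Suc j" "i \<le> j"
      by (metis linorder_neqE_nat less_imp_Suc_add le_add1)
    then show "k \<in> repetitions ?w \<longleftrightarrow> k \<in> insert i (?\<sigma> ` repetitions v)"
    proof cases
      case 1 then show ?thesis using below by (auto simp: image_iff split: if_splits)
    next
      case 2 then show ?thesis using i by simp
    next
      case 3 then show ?thesis using above by (auto simp: image_iff split: if_splits)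
    qed
  qed
qed

text \<open>The shift of positions is injective and misses \<open>i\<close>.\<close>

lemma card_repetitions_degen:
  assumes "i < length v"
  shows "card (repetitions (take (Suc i) v @ drop i v)) = Suc (card (repetitions v))"
proof -
  let ?\<sigma> = "\<lambda>j. if j < i then j else Suc j"
  have "inj ?\<sigma>" by (auto simp: inj_def split: if_splits)
  moreover have "i \<notin> ?\<sigma> ` repetitions v" by (auto split: if_splits)
  ultimately show ?thesis
    by (simp add: repetitions_degen[OF assms] card_image inj_on_subset del: if_image_distrib)
qed

text \<open>This is $s_j d_j v = v$: deleting one of two equal neighbours and doubling the other
  restores the tuple.\<close>

lemma degen_face_repetition:
  assumes "j \<in> repetitions v"
  shows "take (Suc j) (take j v @ drop (Suc j) v) @ drop j (take j v @ drop (Suc j) v) = v"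
proof -
  have j: "Suc j < length v" "v ! j = v ! Suc j"
    using assms by (auto simp: repetitions_def)
  have d: "drop (Suc j) v = v ! j # drop (Suc (Suc j)) v"
    using j by (simp add: Cons_nth_drop_Suc)
  have "drop j v = v ! j # drop (Suc j) v"
    using j(1) by (intro Cons_nth_drop_Suc[symmetric]) simp
  moreover have "take (Suc j) (take j v @ drop (Suc j) v) = take j v @ [v ! j]"
    using j by (simp add: d)
  moreover have "drop j (take j v @ drop (Suc j) v) = drop (Suc j) v"
    using j by simp
  ultimately show ?thesis
    by (metis append_Cons append_Nil append_assoc append_take_drop_id)
qed

lemma admissible_degen_indices:
  assumes "sorted_wrt (>) J" "\<forall>j\<in>set J. j < p + length J"
  shows "degen_indices p J"
  using assms
proof (induction J)
  case (Cons j J)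
  \<comment> \<open>The remaining indices lie strictly below \<open>j\<close>, and \<open>j\<close>
    is at most \<open>p + length J\<close>, so the bound drops by one along with the length.\<close>
  then have "\<forall>i\<in>set J. i < p + length J" by fastforce
  with Cons show ?case by auto
qed simp

section \<open>Images of iterated degeneracies in \<open>Delta K\<close>\<close>

abbreviation Delta_simplices :: "nat set set \<Rightarrow> nat \<Rightarrow> nat list set" where
  "Delta_simplices K n \<equiv> {v. length v = Suc n \<and> sorted v \<and> set v \<in> K}"

lemma Delta_level: "level (Delta K) n = discrete_topology (Delta_simplices K n)"
  by (simp add: Delta_def)

lemma Delta_degen: "degen (Delta K) n i v = take (Suc i) v @ drop i v"
  by (simp add: Delta_def)

text \<open>Indices need not be decreasing here: each single degeneracy preserves the set of
  vertices and adds exactly one repetition.\<close>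

lemma degen_comp_Delta:
  assumes "degen_indices p is" "u \<in> Delta_simplices K p"
  shows "degen_comp (Delta K) p is u \<in> Delta_simplices K (p + length is)"
    and "card (repetitions (degen_comp (Delta K) p is u)) = card (repetitions u) + length is"
  using assms(1)
proof (induction "is")
  case Nil
  { case 1 then show ?case using assms(2) by simp }
  { case 2 then show ?case by simp }
next
  case (Cons i "is")
  let ?w = "degen_comp (Delta K) p is u"
  have w: "?w \<in> Delta_simplices K (p + length is)" if "degen_indices p (i # is)"
    using that Cons by simp
  { case 1
    then show ?case
      using w Delta_degen_closed[of i ?w] by (auto simp: Delta_degen) }
  { case 2
    then show ?case
      using w Cons by (simp add: Delta_degen card_repetitions_degen) }
qed

text \<open>Along a decreasing sequence the degeneracy applied last has the largest index, so it
  does not move the repetitions already created. Conversely, prescribed repetitions can be removed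
  by faces, starting with the largest index.\<close>

lemma degen_comp_Delta_image:
  assumes "sorted_wrt (>) J" "\<forall>j\<in>set J. j < p + length J"
  shows "degen_comp (Delta K) p J ` Delta_simplices K p =
           {v \<in> Delta_simplices K (p + length J). set J \<subseteq> repetitions v}"
  using assms
proof (induction J)
  case Nil
  then show ?case by auto
next
  case (Cons j J)
  let ?n = "p + length J"
  have J: "\<forall>i\<in>set J. i < ?n" "\<forall>i\<in>set J. i < j" "j \<le> ?n"
    using Cons.prems by fastforce+
  then have IH: "degen_comp (Delta K) p J ` Delta_simplices K p =
      {v \<in> Delta_simplices K ?n. set J \<subseteq> repetitions v}"
    using Cons by simp
  \<comment> \<open>Positions in \<open>J\<close> lie below \<open>j\<close>, where $s_j$ shifts
    nothing; position \<open>j\<close> itself is always a repetition after $s_j$.\<close>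
  have rep: "set (j # J) \<subseteq> repetitions (take (Suc j) w @ drop j w) \<longleftrightarrow> set J \<subseteq> repetitions w"
    if "length w = Suc ?n" for w :: "nat list"
  proof -
    have rep: "repetitions (take (Suc j) w @ drop j w) =
        insert j ((\<lambda>i. if i < j then i else Suc i) ` repetitions w)"
      using that J(3) by (intro repetitions_degen) simp
    have "i \<in> repetitions (take (Suc j) w @ drop j w) \<longleftrightarrow> i \<in> repetitions w" if "i \<in> set J" for i
    proof -
      have "i < j" using J(2) that by blast
      then show ?thesis
        unfolding rep by (auto simp: image_iff simp del: if_image_distrib split: if_splits)
    qed
    moreover have "j \<in> repetitions (take (Suc j) w @ drop j w)"
      unfolding rep by blast
    ultimately show ?thesis unfolding list.set insert_subset by blast
  qed
  have "degen_comp (Delta K) p (j # J) ` Delta_simplices K p =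
      (\<lambda>w. take (Suc j) w @ drop j w) ` {v \<in> Delta_simplices K ?n. set J \<subseteq> repetitions v}"
    unfolding IH[symmetric] by (simp add: image_image Delta_degen)
  also have "\<dots> = {v \<in> Delta_simplices K (Suc ?n). set (j # J) \<subseteq> repetitions v}" (is "?L = ?R")
  proof (intro equalityI subsetI)
    fix v assume "v \<in> ?L"
    then obtain w where w: "v = take (Suc j) w @ drop j w" "w \<in> Delta_simplices K ?n"
      "set J \<subseteq> repetitions w" by auto
    then show "v \<in> ?R"
      using rep[of w] J(3) Delta_degen_closed[of j w] by simp
  next
    fix v assume v: "v \<in> ?R"
    \<comment> \<open>The preimage of \<open>v\<close> under $s_j$ is its face $d_j v$.\<close>
    define w where "w = take j v @ drop (Suc j) v"
    have vw: "take (Suc j) w @ drop j w = v"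
      unfolding w_def using v by (intro degen_face_repetition) simp
    have len: "length w = Suc ?n" using v J(3) by (simp add: w_def)
    have "sorted (take j v @ drop j v)" using v by simp
    moreover have "sorted (drop (Suc j) v)" using v sorted_wrt_drop by blast
    ultimately have "sorted w"
      unfolding w_def sorted_append
      using set_drop_subset_set_drop[of j "Suc j" v] by auto
    \<comment> \<open>A degeneracy keeps the set of entries, so \<open>w\<close> spans the same
      simplex of \<open>K\<close> as \<open>v\<close>.\<close>
    moreover have "set w = set v"
      using Delta_degen_closed(2)[of j w] \<open>sorted w\<close> len J(3) vw by simp
    ultimately have "w \<in> Delta_simplices K ?n" using v len by simp
    moreover have "set J \<subseteq> repetitions w" using rep[OF len] v vw by simp
    ultimately show "v \<in> ?L" using vw by force
  qed
  finally show ?case by simp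
qed

section \<open>Admissible sequences, the degeneracy filtration and the base-point\<close>

definition index_list :: "nat list \<Rightarrow> nat list" where
  "index_list v = rev (sorted_list_of_set (repetitions v))"

lemma rev_sorted_list_of_set:
  fixes R :: "nat set"
  assumes "finite R"
  shows "sorted_wrt (>) (rev (sorted_list_of_set R))" "set (rev (sorted_list_of_set R)) = R"
    "length (rev (sorted_list_of_set R)) = card R"
  using assms by (auto simp: sorted_wrt_rev)

lemma index_list_unique:
  assumes "sorted_wrt (>) J" "set J = repetitions v"
  shows "index_list v = J"
proof -
  have "sorted_wrt (<) (rev J)" using assms(1) by (simp add: sorted_wrt_rev)
  then have "sorted_list_of_set (repetitions v) = rev J"
    using assms(2) by (metis set_rev sorted_list_of_set.idem_if_sorted_distinct strict_sorted_iff)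
  then show ?thesis by (simp add: index_list_def)
qed

lemma admissible_index_list:
  assumes "length v = Suc n"
  shows "admissible n (index_list v)" "set (index_list v) = repetitions v"
    "length (index_list v) = card (repetitions v)"
  using rev_sorted_list_of_set[of "repetitions v"] repetitions_subset[of v] assms
  by (auto simp: admissible_def index_list_def)

lemma admissible_length:
  assumes "admissible n J"
  shows "distinct J" "length J = card (set J)" "length J \<le> n"
proof -
  show d: "distinct J"
    using assms by (auto simp: admissible_def sorted_wrt_iff_nth_less distinct_conv_nth)
      (metis linorder_neqE_nat less_irrefl)
  then show l: "length J = card (set J)" by (simp add: distinct_card)
  have "set J \<subseteq> {..<n}" using assms by (auto simp: admissible_def)
  then show "length J \<le> n" using l card_mono[of "{..<n}" "set J"] by simp
qed

text \<open>A $t$-fold composite of degeneracies adds exactly $t$ repetitions; conversely any $t$ of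
  the repetitions of a tuple, in decreasing order, exhibit it as such a composite.\<close>

lemma degen_filtration_Delta:
  "degen_filtration (Delta K) t n = {v \<in> Delta_simplices K n. t \<le> card (repetitions v)}"
proof (cases "t \<le> n")
  case False
  \<comment> \<open>For $t > n$ both sides are empty, as a tuple of length $n+1$ has only $n$ pairs
    of neighbours.\<close>
  have "card (repetitions v) \<le> n" if "length v = Suc n" for v :: "nat list"
    using card_mono[OF _ repetitions_subset[of v]] that by simp
  then show ?thesis using False by (force simp: degen_filtration_def)
next
  case True
  show ?thesis
  proof (intro equalityI subsetI)
    fix v assume "v \<in> degen_filtration (Delta K) t n"
    then obtain "is" u where "length is = t" "degen_indices (n - t) is"
      "u \<in> Delta_simplices K (n - t)" "v = degen_comp (Delta K) (n - t) is u"
      using True by (auto simp: degen_filtration_def Delta_level)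
    then show "v \<in> {v \<in> Delta_simplices K n. t \<le> card (repetitions v)}"
      using degen_comp_Delta[of "n - t" "is" u K] True by simp
  next
    fix v assume v: "v \<in> {v \<in> Delta_simplices K n. t \<le> card (repetitions v)}"
    then obtain R where R: "R \<subseteq> repetitions v" "card R = t"
      using obtain_subset_with_card_n[of t "repetitions v"] by blast
    then have "finite R" using finite_subset by fastforce
    note J = rev_sorted_list_of_set[OF this]
    let ?J = "rev (sorted_list_of_set R)"
    have lt: "\<forall>j\<in>set ?J. j < n - t + length ?J"
      using J R v True repetitions_subset[of v] by auto
    have "v \<in> degen_comp (Delta K) (n - t) ?J ` Delta_simplices K (n - t)"
      using v R J True by (subst degen_comp_Delta_image[OF J(1) lt]) simp
    moreover have "?J \<in> {is. length is = t \<and> degen_indices (n - t) is}"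
      using admissible_degen_indices[OF J(1) lt] J(3) R(2) by simp
    ultimately show "v \<in> degen_filtration (Delta K) t n"
      unfolding degen_filtration_def if_P[OF True] Delta_level topspace_discrete_topology
      by blast
  qed
qed

text \<open>For the second part, a degenerate argument has at least one repetition and $s_J$ adds
  $|J|$ more, so the result repeats at some position besides those in \<open>J\<close>.\<close>

lemma admissible_image:
  assumes "admissible n J"
  shows "degen_comp (Delta K) (n - length J) J ` Delta_simplices K (n - length J) =
           {v \<in> Delta_simplices K n. set J \<subseteq> repetitions v}" (is ?A)
    and "degen_comp (Delta K) (n - length J) J ` degen_filtration (Delta K) 1 (n - length J) =
           {v \<in> Delta_simplices K n. set J \<subset> repetitions v}" (is ?B)
proof -
  let ?p = "n - length J"
  let ?s = "degen_comp (Delta K) ?p J"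
  note J = admissible_length[OF assms]
  have *: "sorted_wrt (>) J" "\<forall>j\<in>set J. j < ?p + length J"
    using assms J by (auto simp: admissible_def)
  show A: ?A using degen_comp_Delta_image[OF *, of K] J by simp
  have card: "card (repetitions (?s u)) = card (repetitions u) + card (set J)"
    if "u \<in> Delta_simplices K ?p" for u
    using degen_comp_Delta(2)[OF admissible_degen_indices[OF *] that] J by simp
  have "?s ` degen_filtration (Delta K) 1 ?p =
      {v \<in> ?s ` Delta_simplices K ?p. card (set J) < card (repetitions v)}"
    using card by (auto simp: degen_filtration_Delta)
  \<comment> \<open>Once \<open>set J\<close> is contained in the finite set of repetitions, strict
    inclusion amounts to a strict inequality of cardinalities.\<close>
  also have "\<dots> = {v \<in> Delta_simplices K n. set J \<subset> repetitions v}"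
    unfolding A using psubset_card_mono[OF finite_repetitions] by (auto simp: psubset_eq)
  finally show ?B .
qed

text \<open>The base-point arises by $n$ degeneracies, hence has at least $n$ repetitions, and only
  $n$ positions exist. It therefore lies in every $S^t(Y_n)$ with $t \<le> n$ and in every
  $s_J(Y_{n-r})$.\<close>

lemma base_at_Delta:
  assumes "y0 \<in> topspace (level (Delta K) 0)"
  shows "base_at (Delta K) y0 n \<in> Delta_simplices K n"
    and "repetitions (base_at (Delta K) y0 n) = {..<n}"
proof -
  let ?b = "base_at (Delta K) y0 n"
  have y0: "y0 \<in> Delta_simplices K 0" using assms by (simp add: Delta_level)
  have di: "degen_indices 0 (replicate k 0)" for k by (induction k) auto
  show b: "?b \<in> Delta_simplices K n"
    using degen_comp_Delta(1)[OF di y0, of n] by (simp add: base_at_def)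
  have "card (repetitions ?b) \<ge> card {..<n}"
    using degen_comp_Delta(2)[OF di y0, of n] by (simp add: base_at_def)
  then show "repetitions ?b = {..<n}"
    using b repetitions_subset[of ?b] by (intro card_seteq) auto
qed

section \<open>The spaces of the theorem as bouquets\<close>

lemma bouquet_filtration_space:
  assumes "y0 \<in> topspace (level (Delta K) 0)" "t \<le> n"
  shows "bouquet (degen_filtration (Delta K) t n) {base_at (Delta K) y0 n}
           (reduced_suspension (filtration_space (Delta K) y0 n t))
           (susp_class (filtration_space (Delta K) y0 n t))"
proof -
  have "bouquet (degen_filtration (Delta K) t n) {snd (filtration_space (Delta K) y0 n t)}
           (reduced_suspension (filtration_space (Delta K) y0 n t))
           (susp_class (filtration_space (Delta K) y0 n t))"
    using base_at_Delta[OF assms(1), of n] assms(2)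
    by (intro bouquet_suspension)
       (auto simp: filtration_space_def Delta_level
         degen_filtration_Delta intro!: arg_cong[where f = discrete_topology])
  then show ?thesis by (simp add: filtration_space_def)
qed

lemma filtration_space_0: "filtration_space (Delta K) y0 n 0 = level_space (Delta K) y0 n"
  by (simp add: filtration_space_def level_space_def degen_filtration_Delta Delta_level)

text \<open>For \<open>r = n\<close> the collapsed set is empty and the base-point is the only label
  with a constant loop; for smaller \<open>r\<close> it already belongs to the collapsed
  set.\<close>

lemma bouquet_filtration_quotient:
  assumes "y0 \<in> topspace (level (Delta K) 0)" "r \<le> n"
  shows "bouquet (degen_filtration (Delta K) r n)
           (insert (base_at (Delta K) y0 n) (degen_filtration (Delta K) (Suc r) n))
           (reduced_suspension (filtration_quotient (Delta K) y0 n r))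
           (\<lambda>x. susp_class (filtration_quotient (Delta K) y0 n r)
                  (collapse_class (degen_filtration (Delta K) (Suc r) n) x))"
  unfolding filtration_quotient_def
proof (rule bouquet_suspension_quotient)
  note b = base_at_Delta[OF assms(1), of n]
  show "filtration_space (Delta K) y0 n r =
      (discrete_topology (degen_filtration (Delta K) r n), base_at (Delta K) y0 n)"
    by (auto simp: filtration_space_def Delta_level
         degen_filtration_Delta intro!: arg_cong[where f = discrete_topology])
  show "base_at (Delta K) y0 n \<in> degen_filtration (Delta K) r n"
    using b assms(2) by (simp add: degen_filtration_Delta)
  show "degen_filtration (Delta K) (Suc r) n \<subseteq> degen_filtration (Delta K) r n"
    by (auto simp: degen_filtration_Delta)
  assume "degen_filtration (Delta K) (Suc r) n \<noteq> {}"
  then have "Suc r \<le> n" by (auto simp: degen_filtration_def split: if_splits)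
  then show "base_at (Delta K) y0 n \<in> degen_filtration (Delta K) (Suc r) n"
    using b by (simp add: degen_filtration_Delta)
qed

abbreviation degen_quotient_class ::
    "nat set set \<Rightarrow> nat list \<Rightarrow> nat \<Rightarrow> nat list \<Rightarrow> nat list \<Rightarrow> real \<Rightarrow> (nat list set \<times> real) set" where
  "degen_quotient_class K y0 n J x \<equiv> susp_class (degen_quotient (Delta K) y0 n J)
     (collapse_class {v \<in> Delta_simplices K n. set J \<subset> repetitions v} x)"

lemma bouquet_degen_quotient:
  assumes "y0 \<in> topspace (level (Delta K) 0)" "admissible n J"
  shows "bouquet {v \<in> Delta_simplices K n. set J \<subseteq> repetitions v}
           (insert (base_at (Delta K) y0 n) {v \<in> Delta_simplices K n. set J \<subset> repetitions v})
           (reduced_suspension (degen_quotient (Delta K) y0 n J))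
           (degen_quotient_class K y0 n J)"
proof -
  let ?P = "{v \<in> Delta_simplices K n. set J \<subseteq> repetitions v}"
  let ?B = "{v \<in> Delta_simplices K n. set J \<subset> repetitions v}"
  let ?b = "base_at (Delta K) y0 n"
  note b = base_at_Delta[OF assms(1), of n]
  have J: "set J \<subseteq> {..<n}" using assms(2) by (auto simp: admissible_def)
  have PQ: "Delta_simplices K n \<inter> ?P = ?P" by blast
  have e: "degen_quotient (Delta K) y0 n J = based_quotient (discrete_topology ?P, ?b) ?B"
    unfolding degen_quotient_def Let_def Delta_level topspace_discrete_topology
      admissible_image[OF assms(2)] subtopology_discrete_topology PQ ..
  show ?thesis
    unfolding e
  proof (rule bouquet_suspension_quotient[OF refl])
    show "?b \<in> ?P" using b J by simp
    \<comment> \<open>A tuple with repetitions beyond \<open>J\<close> shows that \<open>J\<close>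
      omits some position below \<open>n\<close>; the base-point, which repeats everywhere, then
      lies in the collapsed set as well.\<close>
    assume "?B \<noteq> {}"
    then obtain v :: "nat list" where "set J \<subset> repetitions v" "length v = Suc n" by blast
    then have "set J \<subset> {..<n}" using repetitions_subset[of v] by auto
    then show "?b \<in> ?B" using b by simp
  qed auto
qed

lemma admissible_exists:
  assumes "r \<le> n"
  shows "{J. admissible n J \<and> length J = r} \<noteq> {}"
  using assms rev_sorted_list_of_set[of "{..<r}"]
  by (auto simp: admissible_def intro!: exI[of _ "rev (sorted_list_of_set {..<r})"])

abbreviation admissible_class ::
    "nat set set \<Rightarrow> nat list \<Rightarrow> nat \<Rightarrow> nat \<Rightarrow> nat list \<times> nat list \<Rightarrow> real \<Rightarrow>
      (nat list \<times> (nat list set \<times> real) set) set" where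
  "admissible_class K y0 n r \<equiv> wedge_class {J. admissible n J \<and> length J = r}
     (\<lambda>J. reduced_suspension (degen_quotient (Delta K) y0 n J)) (degen_quotient_class K y0 n)"

text \<open>Two applications of \<open>bouquet_wedge\<close>, over $J$ and then over $r$, turn
  labels into triples \<open>(r, J, v)\<close>.\<close>

lemma bouquet_wedge_admissible:
  assumes "y0 \<in> topspace (level (Delta K) 0)" "t \<le> n"
  shows "bouquet
     (SIGMA r:{t..n}. SIGMA J:{J. admissible n J \<and> length J = r}.
        {v \<in> Delta_simplices K n. set J \<subseteq> repetitions v})
     (SIGMA r:{t..n}. SIGMA J:{J. admissible n J \<and> length J = r}.
        insert (base_at (Delta K) y0 n) {v \<in> Delta_simplices K n. set J \<subset> repetitions v})
     (wedge {t..n} (admissible_wedge (Delta K) y0 n))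
     (wedge_class {t..n} (admissible_wedge (Delta K) y0 n) (admissible_class K y0 n))"
  unfolding admissible_wedge_def
  using assms admissible_exists
  by (intro bouquet_wedge bouquet_degen_quotient) auto

section \<open>Matching the circles on both sides\<close>

text \<open>A triple \<open>(r, J, v)\<close> carries a genuine circle exactly when \<open>v\<close>
  is not the base-point and \<open>set J = repetitions v\<close>. Then \<open>v\<close> determines
  \<open>J\<close> and \<open>r\<close>, and forgetting them is the inverse. The formula is the same
  for all \<open>t\<close>, which makes the equivalences compatible.\<close>

lemma bij_betw_index_list:
  assumes "y0 \<in> topspace (level (Delta K) 0)"
  shows "bij_betw (\<lambda>v. (card (repetitions v), index_list v, v))
     (degen_filtration (Delta K) t n - {base_at (Delta K) y0 n})
     ((SIGMA r:{t..n}. SIGMA J:{J. admissible n J \<and> length J = r}.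
        {v \<in> Delta_simplices K n. set J \<subseteq> repetitions v}) -
      (SIGMA r:{t..n}. SIGMA J:{J. admissible n J \<and> length J = r}.
        insert (base_at (Delta K) y0 n) {v \<in> Delta_simplices K n. set J \<subset> repetitions v}))"
    (is "bij_betw ?\<phi> ?A ?B")
proof (rule bij_betwI[where g = "\<lambda>(r, J, v). v"])
  show "?\<phi> \<in> ?A \<rightarrow> ?B"
    using admissible_index_list admissible_length(3)[OF admissible_index_list(1)]
    by (fastforce simp: degen_filtration_Delta)
  have *: "index_list v = J \<and> card (repetitions v) = length J"
    if "(r, J, v) \<in> ?B" for r J v
  proof -
    have "admissible n J" "set J = repetitions v" using that by auto
    then show ?thesis
      using index_list_unique[of J v] admissible_length[of n J] by (auto simp: admissible_def)
  qed
  then show "(\<lambda>(r, J, v). v) \<in> ?B \<rightarrow> ?A"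
    by (force simp: degen_filtration_Delta)
  show "?\<phi> ((\<lambda>(r, J, v). v) y) = y" if "y \<in> ?B" for y
    using that * by fastforce
qed auto

text \<open>Away from the base-point, \<open>v\<close> survives in the stratum \<open>r\<close>
  exactly when it has \<open>r\<close> repetitions.\<close>

lemma bij_betw_strata:
  assumes "y0 \<in> topspace (level (Delta K) 0)"
  shows "bij_betw (\<lambda>v. (card (repetitions v), v))
     (degen_filtration (Delta K) 0 n - {base_at (Delta K) y0 n})
     ((SIGMA r:{0..n}. degen_filtration (Delta K) r n) -
      (SIGMA r:{0..n}. insert (base_at (Delta K) y0 n) (degen_filtration (Delta K) (Suc r) n)))"
proof -
  have "card (repetitions v) \<le> n" if "length v = Suc n" for v :: "nat list"
    using card_mono[OF _ repetitions_subset[of v]] that by simp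
  then show ?thesis
    by (intro bij_betwI[where g = snd]) (auto simp: degen_filtration_Delta)
qed

text \<open>The restriction of \<open>H\<close> is expressed by a commuting square with the
  canonical maps of suspensions and wedges, because the classes in a quotient of a subspace are
  different sets from those in the quotient of the whole space.\<close>

theorem corollary4p6:
  fixes X :: "(real ^ 'k) set" and K :: "nat set set" and m n :: nat and y0 :: "nat list"
  assumes "semialgebraic X" and "compact X" and "X \<noteq> {}"
    and "abstract_simplicial_complex m K"
    and "X homeomorphic geometric_realization K"
    and "y0 \<in> topspace (level (Delta K) 0)"
  shows "(\<exists>\<Theta>. based_homotopy_equivalence
            (reduced_suspension (level_space (Delta K) y0 n))
            (wedge {0..n} (\<lambda>r. reduced_suspension (filtration_quotient (Delta K) y0 n r)))
            \<Theta>) \<and>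
         (\<exists>H. based_homotopy_equivalence
            (reduced_suspension (level_space (Delta K) y0 n))
            (wedge {0..n} (admissible_wedge (Delta K) y0 n))
            H \<and>
            (\<forall>t \<le> n. \<exists>H\<^sub>t.
               based_homotopy_equivalence
                 (reduced_suspension (filtration_space (Delta K) y0 n t))
                 (wedge {t..n} (admissible_wedge (Delta K) y0 n))
                 H\<^sub>t \<and>
               (\<forall>x \<in> topspace (fst (reduced_suspension (filtration_space (Delta K) y0 n t))).
                  H (suspension_inclusion (level_space (Delta K) y0 n) x) =
                  wedge_inclusion {0..n} (admissible_wedge (Delta K) y0 n) (H\<^sub>t x))))"
proof (intro conjI)
  let ?b = "base_at (Delta K) y0 n"
  let ?S = "\<lambda>t. filtration_space (Delta K) y0 n t"
  let ?W = "admissible_wedge (Delta K) y0 n"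
  note b = base_at_Delta[OF assms(6), of n]
  have bouquet_level: "bouquet (degen_filtration (Delta K) 0 n) {?b}
      (reduced_suspension (level_space (Delta K) y0 n)) (susp_class (level_space (Delta K) y0 n))"
    using bouquet_filtration_space[OF assms(6), of 0 n] by (simp add: filtration_space_0)
  have bouquet_strata: "bouquet (SIGMA r:{0..n}. degen_filtration (Delta K) r n)
      (SIGMA r:{0..n}. insert ?b (degen_filtration (Delta K) (Suc r) n))
      (wedge {0..n} (\<lambda>r. reduced_suspension (filtration_quotient (Delta K) y0 n r)))
      (wedge_class {0..n} (\<lambda>r. reduced_suspension (filtration_quotient (Delta K) y0 n r))
        (\<lambda>r x. susp_class (filtration_quotient (Delta K) y0 n r)
                 (collapse_class (degen_filtration (Delta K) (Suc r) n) x)))"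
    by (intro bouquet_wedge bouquet_filtration_quotient[OF assms(6)]) auto
  show "\<exists>\<Theta>. based_homotopy_equivalence (reduced_suspension (level_space (Delta K) y0 n))
      (wedge {0..n} (\<lambda>r. reduced_suspension (filtration_quotient (Delta K) y0 n r))) \<Theta>"
  proof -
    \<comment> \<open>The base-point has \<open>n\<close> repetitions, so its label goes to the last
      summand and carries the constant loop there.\<close>
    have "(card (repetitions v), v) \<in>
        (SIGMA r:{0..n}. insert ?b (degen_filtration (Delta K) (Suc r) n))" if "v \<in> {?b}" for v
      using b that by simp
    then show ?thesis
      using bouquet_equivalence[OF bouquet_level bouquet_strata _ bij_betw_strata[OF assms(6)]]
      by blast
  qed
  let ?\<phi> = "\<lambda>v. (card (repetitions v), index_list v, v)"
  have ex: "\<exists>H\<^sub>t. based_homotopy_equivalence (reduced_suspension (?S t)) (wedge {t..n} ?W) H\<^sub>t \<and>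
      (\<forall>v \<in> degen_filtration (Delta K) t n. \<forall>s \<in> {0..1}.
         H\<^sub>t (susp_class (?S t) v s) =
         wedge_class {t..n} ?W (admissible_class K y0 n) (?\<phi> v) s)" if t: "t \<le> n" for t
  proof (rule bouquet_equivalence[OF bouquet_filtration_space[OF assms(6) t]
        bouquet_wedge_admissible[OF assms(6) t] _ bij_betw_index_list[OF assms(6)]])
    fix v assume "v \<in> {?b}"
    then show "?\<phi> v \<in> (SIGMA r:{t..n}. SIGMA J:{J. admissible n J \<and> length J = r}.
        insert ?b {v \<in> Delta_simplices K n. set J \<subset> repetitions v})"
      using b t admissible_index_list[of ?b n] by auto
  qed
  \<comment> \<open>\<open>H\<close> is the case \<open>t = 0\<close>, since $S^0(Y_n) =
    Y_n$.\<close>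
  obtain H where H: "based_homotopy_equivalence (reduced_suspension (?S 0)) (wedge {0..n} ?W) H"
    "\<forall>v \<in> degen_filtration (Delta K) 0 n. \<forall>s \<in> {0..1}.
       H (susp_class (?S 0) v s) = wedge_class {0..n} ?W (admissible_class K y0 n) (?\<phi> v) s"
    using ex[of 0] by blast
  show "\<exists>H. based_homotopy_equivalence (reduced_suspension (level_space (Delta K) y0 n))
            (wedge {0..n} ?W) H \<and>
          (\<forall>t \<le> n. \<exists>H\<^sub>t.
               based_homotopy_equivalence (reduced_suspension (?S t)) (wedge {t..n} ?W) H\<^sub>t \<and>
               (\<forall>x \<in> topspace (fst (reduced_suspension (?S t))).
                  H (suspension_inclusion (level_space (Delta K) y0 n) x) =
                  wedge_inclusion {0..n} ?W (H\<^sub>t x)))"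
  proof (rule exI[of _ H], intro conjI allI impI)
    show "based_homotopy_equivalence (reduced_suspension (level_space (Delta K) y0 n))
        (wedge {0..n} ?W) H"
      using H(1) by (simp add: filtration_space_0)
    fix t assume t: "t \<le> n"
    obtain H\<^sub>t where Ht: "based_homotopy_equivalence (reduced_suspension (?S t)) (wedge {t..n} ?W) H\<^sub>t"
      "\<forall>v \<in> degen_filtration (Delta K) t n. \<forall>s \<in> {0..1}.
         H\<^sub>t (susp_class (?S t) v s) = wedge_class {t..n} ?W (admissible_class K y0 n) (?\<phi> v) s"
      using ex[OF t] by blast
    show "\<exists>H\<^sub>t. based_homotopy_equivalence (reduced_suspension (?S t)) (wedge {t..n} ?W) H\<^sub>t \<and>
        (\<forall>x \<in> topspace (fst (reduced_suspension (?S t))).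
           H (suspension_inclusion (level_space (Delta K) y0 n) x) =
           wedge_inclusion {0..n} ?W (H\<^sub>t x))"
    proof (intro exI[of _ H\<^sub>t] conjI ballI)
      show "based_homotopy_equivalence (reduced_suspension (?S t)) (wedge {t..n} ?W) H\<^sub>t"
        by (fact Ht(1))
      fix x assume "x \<in> topspace (fst (reduced_suspension (?S t)))"
      then obtain v s where v: "v \<in> degen_filtration (Delta K) t n" "s \<in> {0..1}"
        "x = susp_class (?S t) v s"
        using bouquet_topspace[OF bouquet_filtration_space[OF assms(6) t]] by auto
      \<comment> \<open>Both spaces have the same base-point, so the inclusion sends the class of
        \<open>(v, s)\<close> to the class of \<open>(v, s)\<close>.\<close>
      have "suspension_collapsed (?S t) \<subseteq> suspension_collapsed (level_space (Delta K) y0 n)"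
        by (auto simp: suspension_collapsed_def filtration_space_def level_space_def)
      then have "suspension_inclusion (level_space (Delta K) y0 n) x = susp_class (?S 0) v s"
        by (simp add: v susp_class_def suspension_inclusion_def induced_map_id filtration_space_0)
      moreover have "v \<in> degen_filtration (Delta K) 0 n"
        using v by (simp add: degen_filtration_Delta)
      \<comment> \<open>Likewise the wedge inclusion keeps label and parameter, so both ways around
        the square end at the loop of \<open>?\<phi> v\<close> at \<open>s\<close>.\<close>
      moreover have "wedge_collapsed {t..n} ?W \<subseteq> wedge_collapsed {0..n} ?W"
        by (auto simp: wedge_collapsed_def)
      then have "wedge_inclusion {0..n} ?W
            (wedge_class {t..n} ?W (admissible_class K y0 n) (?\<phi> v) s) =
          wedge_class {0..n} ?W (admissible_class K y0 n) (?\<phi> v) s"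
        by (simp add: wedge_class_def wedge_inclusion_def induced_map_id)
      ultimately show "H (suspension_inclusion (level_space (Delta K) y0 n) x) =
          wedge_inclusion {0..n} ?W (H\<^sub>t x)"
        using H(2) Ht(2) v by simp
    qed
  qed
qed

end
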